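(* Let $G=(V,E)$ be a finite simple undirected graph, let $\kappa:V\to\mathbb{N}_0$ be a capacity function, let $X=\{0,1,\dots,\bar x\}$ be the common action set, and let all players share the utility form $$U_i(\boldsymbol{x},\boldsymbol{m})=f\Big(x_i+\sum_{\{j\in N_G(i)\,:\, i\in m_j\}}x_j\Big)-c\,x_i ,$$ where $c>0$ and there is $q^*\in X$ such that $q^*\in\operatorname{argmax}_{x\in X}(f(x)-cx)$ and $f(x)-cx$ is non-increasing for $x\ge q^*$. Then the public goods game with sharing constraints on $(G,\kappa)$ has a specialised pure strategy Nash equilibrium, that is, a pure strategy Nash equilibrium $(\boldsymbol{x}^*,\boldsymbol{m}^* )$ in which $x_i^*\in\{0,q^*\}$ for every $i\in V$.
   Context: $\mathbb{N}_0$ is the set of non-negative integers. $N_G(i)$ is the set of neighbours of $i$ in $G$ and $d_G(i)=|N_G(i)|$. The function $f$ is real-valued on $\mathbb{N}_0$, and "$f(x)-cx$ is non-increasing for $x\ge q^*$" refers to all integers $x\ge q^*$ (also those larger than $\bar x$). The public goods game with sharing constraints on $(G,\kappa)$: the players are the vertices $V=\{1,\dots,n\}$. A pure strategy of player $i$ is a pair $(x_i,m_i)$ with $x_i\in X$ (the action) and $m_i\in M_i$ (the nomination), where $M_i=\{S\subseteq N_G(i): |S|=\min\{\kappa(i),d_G(i)\}\}$. A pure strategy profile is $(\boldsymbol{x},\boldsymbol{m})=((x_1,\dots,x_n),(m_1,\dots,m_n))$; payoffs are the $U_i$ in the claim. A profile $(\boldsymbol{x}^*,\boldsymbol{m}^*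 )$ is a pure strategy Nash equilibrium if for every player $i$ and all $x_i\in X$, $m_i\in M_i$, replacing $(x_i^*,m_i^* )$ by $(x_i,m_i)$ (with the other players unchanged) does not increase $U_i$. *)

theory Defs
  imports Complex_Main "HOL-Library.FuncSet"
begin

definition simple_graph :: "'a set \<Rightarrow> 'a set set \<Rightarrow> bool" where
  "simple_graph V E \<longleftrightarrow> finite V \<and> (\<forall>e\<in>E. e \<subseteq> V \<and> card e = 2)"

definition neighbours :: "'a set set \<Rightarrow> 'a \<Rightarrow> 'a set" where
  "neighbours E i = {j. {i, j} \<in> E}"

definition degree :: "'a set set \<Rightarrow> 'a \<Rightarrow> nat" where
  "degree E i = card (neighbours E i)"

text \<open>Strategic-form games: \<open>P\<close> is the set of players, \<open>S i\<close> the pure strategies of player \<open>i\<close>,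
  and \<open>U i s\<close> the payoff of player \<open>i\<close> at the profile \<open>s\<close>. Profiles are extensional functions,
  so that \<open>Pi\<^sub>E P S\<close> is the Cartesian product of the strategy sets.\<close>

definition pure_nash_equilibrium ::
    "'a set \<Rightarrow> ('a \<Rightarrow> 's set) \<Rightarrow> ('a \<Rightarrow> ('a \<Rightarrow> 's) \<Rightarrow> real) \<Rightarrow> ('a \<Rightarrow> 's) \<Rightarrow> bool" where
  "pure_nash_equilibrium P S U s \<longleftrightarrow>
     s \<in> Pi\<^sub>E P S \<and> (\<forall>i\<in>P. \<forall>t\<in>S i. U i (s(i := t)) \<le> U i s)"

definition nominations :: "'a set set \<Rightarrow> ('a \<Rightarrow> nat) \<Rightarrow> 'a \<Rightarrow> 'a set set" where
  "nominations E \<kappa> i = {S. S \<subseteq> neighbours E i \<and> card S = min (\<kappa> i) (degree E i)}"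

text \<open>A strategy is a pair \<open>(x, m)\<close> of an action and a nomination.\<close>

definition sharing_strategies ::
    "'a set set \<Rightarrow> ('a \<Rightarrow> nat) \<Rightarrow> nat set \<Rightarrow> 'a \<Rightarrow> (nat \<times> 'a set) set" where
  "sharing_strategies E \<kappa> X i = X \<times> nominations E \<kappa> i"

definition sharing_payoff ::
    "'a set set \<Rightarrow> (nat \<Rightarrow> real) \<Rightarrow> real \<Rightarrow> 'a \<Rightarrow> ('a \<Rightarrow> nat \<times> 'a set) \<Rightarrow> real" where
  "sharing_payoff E f c i s =
     f (fst (s i) + (\<Sum>j\<in>{j \<in> neighbours E i. i \<in> snd (s j)}. fst (s j))) - c * real (fst (s i))"

end

theory Submission
  imports Defs
begin

text \<open>
  Write \<open>k i = min (\<kappa> i) (degree E i)\<close>. It suffices to find a set \<open>D\<close> of contributors (playing \<open>q\<close>)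
  such that every \<open>i \<in> D\<close> can nominate \<open>k i\<close> neighbours outside \<open>D\<close> and every vertex outside \<open>D\<close> is
  nominated by some member of \<open>D\<close>: contributors then receive nothing, and the others receive at
  least \<open>q\<close>. Such a \<open>D\<close> is built greedily, keeping a set \<open>U\<close> of undecided vertices \<open>w\<close>, each with at
  least \<open>k w\<close> neighbours outside \<open>D\<close>. If some \<open>v \<in> U\<close> is tight (exactly \<open>k v\<close> such neighbours), add
  it to \<open>D\<close> and let it nominate all of them, so that no undecided vertex remains adjacent to it.
  Otherwise add any \<open>v \<in> U\<close> with arbitrary nominees outside \<open>D\<close>: undecided vertices have slack, so
  each of them can afford one more neighbour in \<open>D\<close>.
\<close>

lemma extend_nominating_set:
  fixes N :: "'a \<Rightarrow> 'a set" and k :: "'a \<Rightarrow> nat"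
  assumes fin: "finite V"
    and N_sub: "\<And>v. N v \<subseteq> V"
    and irrefl: "\<And>v. v \<notin> N v"
    and sym: "\<And>v w. w \<in> N v \<Longrightarrow> v \<in> N w"
    and "D \<subseteq> V" "U \<subseteq> V" "D \<inter> U = {}"
    and "\<And>v. v \<in> D \<Longrightarrow> m v \<subseteq> N v - D - U \<and> card (m v) = k v"
    and "V - D - U \<subseteq> (\<Union>v\<in>D. m v)"
    and "\<And>w. w \<in> U \<Longrightarrow> k w \<le> card (N w - D)"
  shows "\<exists>D m. D \<subseteq> V \<and> (\<forall>v\<in>D. m v \<subseteq> N v - D \<and> card (m v) = k v) \<and> V - D \<subseteq> (\<Union>v\<in>D. m v)"
  using assms(5-)
proof (induction "card U" arbitrary: D U m rule: less_induct)
  case less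
  note nominees = less.prems(4) and covered = less.prems(5) and slack = less.prems(6)
  have finN: "finite (N v)" for v
    using fin N_sub by (rule finite_subset[rotated])
  have finU: "finite U"
    using fin less.prems(2) by (rule finite_subset[rotated])
  show ?case
  proof (cases "U = {}")
    case True
    then show ?thesis
      using less.prems by (intro exI[of _ D] exI[of _ m]) auto
  next
    case False
    \<comment> \<open>Both greedy choices are merged: strict slack is demanded only of undecided
      neighbours of \<open>v\<close> outside \<open>S\<close>, as members of \<open>S\<close> leave
      \<open>U\<close>. For a tight \<open>v\<close>, \<open>S = N v - D\<close> contains every
      undecided neighbour, so \<open>rest\<close> is vacuous.\<close>
    obtain v S where v: "v \<in> U" and S: "S \<subseteq> N v - D" "card S = k v"
      and rest: "\<And>w. w \<in> U - S \<Longrightarrow> w \<in> N v \<Longrightarrow> k w < card (N w - D)"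
    proof (cases "\<exists>v\<in>U. card (N v - D) = k v")
      case True
      then obtain v where "v \<in> U" "card (N v - D) = k v"
        by blast
      then show ?thesis
        using that[of v "N v - D"] less.prems(3) by auto
    next
      case no_tight: False
      from False obtain v where v: "v \<in> U"
        by blast
      obtain S where "S \<subseteq> N v - D" "card S = k v"
        using obtain_subset_with_card_n[OF slack[OF v]] by blast
      moreover have "k w < card (N w - D)" if "w \<in> U" for w
        using slack[OF that] no_tight that by (metis le_neq_implies_less)
      ultimately show ?thesis
        using that[of v S] v by blast
    qed
    define D' where "D' = insert v D"
    define U' where "U' = U - insert v S"
    define m' where "m' = m(v := S)"
    have "v \<notin> D"
      using v less.prems(3) by blast
    show ?thesis
    proof (rule less.hyps[of U' D' m'])
      show "card U' < card U"
        using v finU by (auto simp: U'_def intro!: psubset_card_mono)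
      show "D' \<subseteq> V" "U' \<subseteq> V" "D' \<inter> U' = {}"
        using v less.prems(1-3) by (auto simp: D'_def U'_def)
      \<comment> \<open>Earlier nominees lie outside \<open>U\<close>, so \<open>v\<close> is not
        among them and its joining \<open>D\<close> spoils no earlier nomination.\<close>
      show "m' w \<subseteq> N w - D' - U' \<and> card (m' w) = k w" if "w \<in> D'" for w
      proof (cases "w = v")
        case True
        then show ?thesis
          using S irrefl[of v] by (auto simp: m'_def D'_def U'_def)
      next
        case False
        then show ?thesis
          using that nominees[of w] v by (auto simp: m'_def D'_def U'_def)
      qed
      show "V - D' - U' \<subseteq> (\<Union>w\<in>D'. m' w)"
        using covered \<open>v \<notin> D\<close> by (fastforce simp: m'_def D'_def U'_def)
      \<comment> \<open>A neighbour of \<open>v\<close> loses exactly one neighbour outside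
        \<open>D\<close>, which its strict slack absorbs.\<close>
      show "k w \<le> card (N w - D')" if "w \<in> U'" for w
      proof (cases "w \<in> N v")
        case True
        then have "k w < card (N w - D)"
          using rest that by (auto simp: U'_def)
        moreover have "N w - D' = N w - D - {v}"
          by (auto simp: D'_def)
        moreover have "v \<in> N w - D"
          using sym[OF True] \<open>v \<notin> D\<close> by blast
        ultimately show ?thesis
          using finN[of w] by (simp add: card_Diff_singleton)
      next
        case False
        then have "N w - D' = N w - D"
          using sym by (auto simp: D'_def)
        then show ?thesis
          using slack[of w] that by (auto simp: U'_def)
      qed
    qed
  qed
qed

theorem theorem1:
  fixes V :: "'a set" and E :: "'a set set" and \<kappa> :: "'a \<Rightarrow> nat"
    and xbar q :: nat and f :: "nat \<Rightarrow> real" and c :: real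
  assumes "simple_graph V E"
    and "c > 0"
    and "is_arg_max (\<lambda>x. f x - c * real x) (\<lambda>x. x \<in> {0..xbar}) q"
    and "antimono_on {q..} (\<lambda>x. f x - c * real x)"
  shows "\<exists>s. pure_nash_equilibrium V (sharing_strategies E \<kappa> {0..xbar}) (sharing_payoff E f c) s
           \<and> (\<forall>i\<in>V. fst (s i) \<in> {0, q})"
proof -
  define N where "N = neighbours E"
  define k where "k i = min (\<kappa> i) (degree E i)" for i
  have fin: "finite V" and N_sub: "N v \<subseteq> V" and irrefl: "v \<notin> N v" for v
    using assms(1) by (force simp: simple_graph_def N_def neighbours_def)+
  have sym: "w \<in> N v \<Longrightarrow> v \<in> N w" for v w
    by (simp add: N_def neighbours_def insert_commute)
  have finN: "finite (N v)" for v
    using fin N_sub by (rule finite_subset[rotated])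
  have k_le: "k v \<le> card (N v)" for v
    by (simp add: k_def degree_def N_def)
  have "\<exists>D m. D \<subseteq> V \<and> (\<forall>v\<in>D. m v \<subseteq> N v - D \<and> card (m v) = k v) \<and> V - D \<subseteq> (\<Union>v\<in>D. m v)"
    by (rule extend_nominating_set[where D = "{}" and U = V]) (use fin N_sub irrefl sym k_le in auto)
  then obtain D m where D: "D \<subseteq> V"
    and m: "\<And>v. v \<in> D \<Longrightarrow> m v \<subseteq> N v - D" "\<And>v. v \<in> D \<Longrightarrow> card (m v) = k v"
    and cover: "V - D \<subseteq> (\<Union>v\<in>D. m v)"
    by blast
  \<comment> \<open>Non-contributors must nominate too; any admissible set will do, since they share
    the action 0.\<close>
  have "\<exists>S. S \<subseteq> N v \<and> card S = k v" for v
    using obtain_subset_with_card_n[OF k_le] by metis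
  then obtain m0 where m0: "\<And>v. m0 v \<subseteq> N v" "\<And>v. card (m0 v) = k v"
    by metis
  define s where "s = (\<lambda>i\<in>V. if i \<in> D then (q, m i) else (0, m0 i))"
  have q: "q \<le> xbar" and q_max: "\<And>x. x \<le> xbar \<Longrightarrow> f x - c * real x \<le> f q - c * real q"
    using assms(3) by (force simp: is_arg_max_linorder)+
  have nominations: "nominations E \<kappa> i = {S. S \<subseteq> N i \<and> card S = k i}" for i
    by (simp add: nominations_def k_def N_def)
  have "s i \<in> sharing_strategies E \<kappa> {0..xbar} i" if "i \<in> V" for i
  proof (cases "i \<in> D")
    case True
    then show ?thesis
      using that m[OF True] q by (auto simp: s_def sharing_strategies_def nominations)
  next
    case False
    then show ?thesis
      using that m0[of i] by (simp add: s_def sharing_strategies_def nominations)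
  qed
  then have s_strategy: "s \<in> Pi\<^sub>E V (sharing_strategies E \<kappa> {0..xbar})"
    by (simp add: s_def PiE_iff)
  have "sharing_payoff E f c i (s(i := t)) \<le> sharing_payoff E f c i s"
    if i: "i \<in> V" and t: "t \<in> sharing_strategies E \<kappa> {0..xbar} i" for i t
  proof -
    \<comment> \<open>As \<open>i\<close> is not its own neighbour, a deviation by \<open>i\<close>
      changes neither its nominators \<open>J\<close> nor the amount \<open>r\<close> it
      receives.\<close>
    define J where "J = {j \<in> N i. i \<in> snd (s j)}"
    define r where "r = (\<Sum>j\<in>J. fst (s j))"
    have payoff_s: "sharing_payoff E f c i s = f (fst (s i) + r) - c * real (fst (s i))"
      by (simp add: sharing_payoff_def r_def J_def N_def)
    have "{j \<in> N i. i \<in> snd ((s(i := t)) j)} = J"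
      using irrefl[of i] by (auto simp: J_def)
    moreover have "(\<Sum>j\<in>J. fst ((s(i := t)) j)) = r"
      unfolding r_def using irrefl[of i] by (intro sum.cong) (auto simp: J_def)
    ultimately have payoff_t: "sharing_payoff E f c i (s(i := t)) = f (fst t + r) - c * real (fst t)"
      by (simp add: sharing_payoff_def N_def)
    have t_le: "fst t \<le> xbar"
      using t by (auto simp: sharing_strategies_def)
    show ?thesis
    proof (cases "i \<in> D")
      case True
      \<comment> \<open>Contributors nominate only outside \<open>D\<close>, so every nominator of
        \<open>i\<close> plays 0.\<close>
      have "fst (s j) = 0" if "j \<in> J" for j
        using that True m(1)[of j] N_sub[of i] by (auto simp: J_def s_def split: if_splits)
      then have "r = 0"
        by (simp add: r_def)
      moreover have "fst (s i) = q"
        using i True by (simp add: s_def)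
      ultimately show ?thesis
        using q_max[OF t_le] by (simp add: payoff_s payoff_t)
    next
      case False
      with i cover obtain j where j: "j \<in> D" "i \<in> m j"
        by blast
      then have "j \<in> J" "fst (s j) = q"
        using m(1)[OF j(1)] D sym[of i j] by (auto simp: J_def s_def)
      then have "q \<le> r"
        using finN[of i] member_le_sum[of j J "\<lambda>j. fst (s j)"] by (simp add: r_def J_def)
      \<comment> \<open>Here \<open>r + fst t\<close> may exceed \<open>xbar\<close>, hence
        monotonicity on all of \<open>{q..}\<close>. Adding \<open>c * r\<close> to both sides
        compares the payoffs.\<close>
      then have "f (r + fst t) - c * real (r + fst t) \<le> f r - c * real r"
        using assms(4) by (auto dest!: monotone_onD[where x = r and y = "r + fst t"])
      moreover have "fst (s i) = 0"
        using i False by (simp add: s_def)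
      ultimately show ?thesis
        by (simp add: payoff_s payoff_t algebra_simps)
    qed
  qed
  moreover have "\<forall>i\<in>V. fst (s i) \<in> {0, q}"
    by (simp add: s_def)
  ultimately show ?thesis
    using s_strategy by (auto simp: pure_nash_equilibrium_def)
qed

end
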